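(* Let $\mathscr A$ be a $C^*$-algebra, let $\mathscr E$ be a Hilbert $C^*$-module over $\mathscr A$, and let $\mathscr H$ and $\mathscr K$ be orthogonally complemented closed submodules of $\mathscr E$. The following statements are equivalent: (i) $(\mathscr H,\mathscr K)$ is a separated pair. (ii) There are idempotents $\Pi_1$ and $\Pi_2$ in $\mathcal L(\mathscr E)$ such that $\Pi_1\Pi_2=\Pi_2\Pi_1=0$, $\mathscr R(\Pi_1)=\mathscr H$ and $\mathscr R(\Pi_2)=\mathscr K$. (iii) There is an idempotent $\Pi\in\mathcal L(\mathscr E)$ such that $\mathscr R(\Pi)=\mathscr H$ and $\mathscr K\subseteq \mathscr N(\Pi)$.
   Context: $\mathcal L(\mathscr E)$ is the set of all adjointable operators on $\mathscr E$; $\mathscr R(T)$ and $\mathscr N(T)$ denote the range and the null space of $T$. An idempotent is an operator $\Pi$ with $\Pi^2=\Pi$ (not necessarily self-adjoint). For a submodule $\mathscr M\subseteq\mathscr E$, $\mathscr M^\perp=\{x\in\mathscr E:\langle x,y\rangle=0\text{ for all }y\in\mathscr M\}$, and $\mathscr M$ is orthogonally complemented in $\mathscr E$ if $\mathscr M\oplus\mathscr M^\perp=\mathscr E$. A pair $(\mathscr H,\mathscr K)$ of closed submodules of $\mathscr E$ is a separated pair if $\mathscr H\cap\mathscr K=0$ and $\mathscr H+\mathscr K$ is orthogonally complemented in $\mathscr E$. *)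

theory Defs
  imports "HOL-Analysis.Analysis"
begin

class complex_vector = real_vector +
  fixes scaleC :: "complex \<Rightarrow> 'a \<Rightarrow> 'a" (infixr "*\<^sub>C" 75)
  assumes scaleC_add_right: "c *\<^sub>C (x + y) = c *\<^sub>C x + c *\<^sub>C y"
    and scaleC_add_left: "(c + d) *\<^sub>C x = c *\<^sub>C x + d *\<^sub>C x"
    and scaleC_scaleC: "c *\<^sub>C d *\<^sub>C x = (c * d) *\<^sub>C x"
    and scaleC_one: "1 *\<^sub>C x = x"
    and scaleR_scaleC: "r *\<^sub>R x = complex_of_real r *\<^sub>C x"

text \<open>C*-algebras, not assumed to be unital (nor nonzero).\<close>

class cstar_algebra = complex_vector + real_normed_algebra + banach +
  fixes star :: "'a \<Rightarrow> 'a"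
  assumes scaleC_mult_left: "(c *\<^sub>C x) * y = c *\<^sub>C (x * y)"
    and scaleC_mult_right: "x * (c *\<^sub>C y) = c *\<^sub>C (x * y)"
    and norm_scaleC: "norm (c *\<^sub>C x) = cmod c * norm x"
    and star_add: "star (x + y) = star x + star y"
    and star_scaleC: "star (c *\<^sub>C x) = cnj c *\<^sub>C star x"
    and star_mult: "star (x * y) = star y * star x"
    and star_star: "star (star x) = x"
    and cstar_identity: "norm (star x * x) = (norm x)\<^sup>2"

instantiation complex :: cstar_algebra
begin

definition scaleC_complex :: "complex \<Rightarrow> complex \<Rightarrow> complex" where
  "scaleC_complex c x = c * x"

definition star_complex :: "complex \<Rightarrow> complex" where
  "star_complex = cnj"

instance
  by standard
    (simp_all add: scaleC_complex_def star_complex_def algebra_simps norm_mult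
      scaleR_conv_of_real power2_eq_square)

end

definition cstar_positive :: "'a::cstar_algebra \<Rightarrow> bool" where
  "cstar_positive a \<longleftrightarrow> (\<exists>b. a = star b * b)"

text \<open>Right modules, with an inner product linear in the second variable. The norm of the type
  \<^typ>\<open>'e\<close> is required to be the one given by the inner product, so that the class
  \<^class>\<open>banach\<close> expresses completeness of the module and \<^const>\<open>closed\<close> refers to the topology
  of the module.\<close>

locale hilbert_cstar_module =
  fixes act :: "'e::{complex_vector, banach} \<Rightarrow> 'a::cstar_algebra \<Rightarrow> 'e"
    and ip :: "'e \<Rightarrow> 'e \<Rightarrow> 'a"
  assumes act_add_left: "act (x + y) a = act x a + act y a"
    and act_add_right: "act x (a + b) = act x a + act x b"
    and act_act: "act (act x a) b = act x (a * b)"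
    and act_scaleC_left: "act (c *\<^sub>C x) a = c *\<^sub>C act x a"
    and act_scaleC_right: "act x (c *\<^sub>C a) = c *\<^sub>C act x a"
    and ip_add_right: "ip x (y + z) = ip x y + ip x z"
    and ip_scaleC_right: "ip x (c *\<^sub>C y) = c *\<^sub>C ip x y"
    and ip_act_right: "ip x (act y a) = ip x y * a"
    and ip_star: "ip y x = star (ip x y)"
    and ip_positive: "cstar_positive (ip x x)"
    and ip_definite: "ip x x = 0 \<Longrightarrow> x = 0"
    and norm_ip: "norm x = sqrt (norm (ip x x))"

lemma hilbert_cstar_module_self:
  "hilbert_cstar_module (*) (\<lambda>x y :: 'a::cstar_algebra. star x * y)"
proof
  fix x y :: 'a
  show "cstar_positive (star x * x)"
    by (auto simp: cstar_positive_def)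
  show "star x * x = 0 \<Longrightarrow> x = 0"
    by (metis cstar_identity norm_eq_zero power_eq_0_iff)
qed (simp_all add: algebra_simps scaleC_mult_left scaleC_mult_right star_mult star_star
    cstar_identity)

definition submodule ::
  "('e::complex_vector \<Rightarrow> 'a \<Rightarrow> 'e) \<Rightarrow> 'e set \<Rightarrow> bool" where
  "submodule act M \<longleftrightarrow> 0 \<in> M \<and> (\<forall>x\<in>M. \<forall>y\<in>M. x + y \<in> M) \<and>
     (\<forall>c. \<forall>x\<in>M. c *\<^sub>C x \<in> M) \<and> (\<forall>a. \<forall>x\<in>M. act x a \<in> M)"

definition closed_submodule ::
  "('e::{complex_vector, banach} \<Rightarrow> 'a \<Rightarrow> 'e) \<Rightarrow> 'e set \<Rightarrow> bool" where
  "closed_submodule act M \<longleftrightarrow> submodule act M \<and> closed M"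

definition orth_compl :: "('e \<Rightarrow> 'e \<Rightarrow> 'a::zero) \<Rightarrow> 'e set \<Rightarrow> 'e set" where
  "orth_compl ip M = {x. \<forall>y\<in>M. ip x y = 0}"

definition orth_complemented :: "('e::ab_group_add \<Rightarrow> 'e \<Rightarrow> 'a::zero) \<Rightarrow> 'e set \<Rightarrow> bool" where
  "orth_complemented ip M \<longleftrightarrow> M \<inter> orth_compl ip M = {0} \<and> M + orth_compl ip M = UNIV"

definition separated_pair ::
  "('e::{complex_vector, banach} \<Rightarrow> 'a \<Rightarrow> 'e) \<Rightarrow> ('e \<Rightarrow> 'e \<Rightarrow> 'a::zero) \<Rightarrow> 'e set \<Rightarrow> 'e set \<Rightarrow> bool" where
  "separated_pair act ip H K \<longleftrightarrow> closed_submodule act H \<and> closed_submodule act K \<and>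
     H \<inter> K = {0} \<and> orth_complemented ip (H + K)"

text \<open>No linearity or boundedness is required: over a Hilbert C*-module both follow from
  the existence of the adjoint \<open>S\<close>.\<close>

definition adjointable :: "('e \<Rightarrow> 'e \<Rightarrow> 'a) \<Rightarrow> ('e \<Rightarrow> 'e) \<Rightarrow> bool" where
  "adjointable ip T \<longleftrightarrow> (\<exists>S. \<forall>x y. ip (T x) y = ip x (S y))"

definition adjointable_ops :: "('e \<Rightarrow> 'e \<Rightarrow> 'a) \<Rightarrow> ('e \<Rightarrow> 'e) set" where
  "adjointable_ops ip = {T. adjointable ip T}"

definition idempotent :: "('e \<Rightarrow> 'e) \<Rightarrow> bool" where
  "idempotent P \<longleftrightarrow> P \<circ> P = P"

definition null_space :: "('e \<Rightarrow> 'e::zero) \<Rightarrow> 'e set" where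
  "null_space T = {x. T x = 0}"

end

theory Submission
  imports Defs
begin

text \<open>Call idempotents whose products vanish in both orders complementary. If \<open>(H, K)\<close> is a separated
  pair, every \<open>x\<close> has a unique decomposition \<open>x = f x + g x + m\<close> with \<open>f x \<in> H\<close>, \<open>g x \<in> K\<close> and \<open>m\<close>
  orthogonal to \<open>H + K\<close>. The maps \<open>f\<close> and \<open>g\<close> are complementary idempotents with the right ranges, and
  the closed graph theorem bounds them; the difficulty is that a bounded operator on a Hilbert
  C*-module need not have an adjoint. Let \<open>p\<close>, \<open>q\<close>, \<open>r\<close> be the orthogonal projections onto \<open>H\<close>, \<open>K\<close> and
  \<open>H + K\<close>. The operator \<open>S = p + q + (1 - r)\<close> is self-adjoint, and reading off the components of its
  values gives \<open>f S = p\<close> and \<open>g S = q\<close>. If \<open>S\<close> is invertible, then \<open>f = p S\<^sup>-\<^sup>1\<close> has the adjoint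
  \<open>S\<^sup>-\<^sup>1 p\<close>, and likewise for \<open>g\<close>.

  In the other direction, let \<open>P\<close> be an adjointable idempotent with range \<open>H\<close> that annihilates \<open>K\<close>.
  Then \<open>H \<inter> K = 0\<close>, and \<open>J = P + q (1 - P)\<close> is an adjointable idempotent with range \<open>H + K\<close>. For any
  adjointable idempotent \<open>J\<close> the operator \<open>W = J + J* - 1\<close> is self-adjoint; if it is surjective, then
  \<open>W y = J y - (1 - J*) y\<close> splits every vector into a part in the range of \<open>J\<close> and a part in the null
  space of \<open>J*\<close>, which is the orthogonal complement of that range.

  Both directions thus need a criterion for surjectivity, and vanishing of an orthogonal complement
  is not one in a Hilbert C*-module. The criterion here is that a self-adjoint operator \<open>S\<close> which is
  bounded below is surjective (\<open>selfadjoint_bounded_below_surj\<close>). Since \<open>S x + i t x\<close> and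
  \<open>S x - i t x\<close> have the same inner square, they have the same norm, and the triangle inequality
  for their sum gives \<open>\<parallel>S x\<parallel> \<le> \<parallel>S x + i t x\<parallel>\<close>. The operators \<open>S + i t\<close> are therefore bounded
  below uniformly in \<open>t\<close>, and surjectivity propagates from large \<open>t\<close>, where \<open>i t\<close> dominates, down to
  \<open>t = 0\<close>. The lower bounds for the two operators \<open>S\<close> and \<open>W\<close> above come from a Cauchy-Schwarz
  inequality with constant 4, which follows from polarization.\<close>

section \<open>Operators on Banach spaces\<close>

text \<open>By the Baire category theorem the closure of some set \<open>{x. \<parallel>f x\<parallel> \<le> n}\<close> contains a ball. Hence
  every \<open>y\<close> is approximated to within half its norm by a \<open>v\<close> with \<open>\<parallel>f v\<parallel> \<le> c \<parallel>y\<parallel>\<close>, where \<open>c\<close> is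
  independent of \<open>y\<close>. Iterating on the remainders writes \<open>y\<close> as a series whose image under \<open>f\<close>
  converges absolutely, and the closed graph identifies the sum of the images with \<open>f y\<close>.\<close>

lemma closed_graph_bounded_linear:
  fixes f :: "'a::banach \<Rightarrow> 'b::banach"
  assumes lin: "linear f"
    and graph: "\<And>X x z. X \<longlonglongrightarrow> x \<Longrightarrow> (\<lambda>n. f (X n)) \<longlonglongrightarrow> z \<Longrightarrow> f x = z"
  shows "bounded_linear f"
proof -
  define V where "V = (\<lambda>n::nat. {x. norm (f x) \<le> real n})"
  have "\<exists>n. interior (closure (V n)) \<noteq> {}"
  proof (rule ccontr)
    assume "\<not> ?thesis"
    then have "euclidean interior_of (\<Union>n. closure (V n)) = {}"
      by (intro Baire_category_alt) (auto simp: completely_metrizable_space_euclidean)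
    moreover have "(\<Union>n. closure (V n)) = UNIV"
    proof -
      have "x \<in> (\<Union>n. closure (V n))" for x
        using real_arch_simple[of "norm (f x)"] closure_subset by (fastforce simp: V_def)
      then show ?thesis by blast
    qed
    ultimately show False by simp
  qed
  then obtain n x0 where "x0 \<in> interior (closure (V n))" by blast
  then obtain r where r: "r > 0" and ball: "cball x0 r \<subseteq> closure (V n)"
    by (meson mem_interior_cball)
  have approx: "\<exists>v. norm (f v) \<le> real n / r * norm y \<and> norm (y - v) \<le> norm y / 2" for y
  proof (cases "y = 0")
    case True
    then show ?thesis using linear_0[OF lin] by (intro exI[of _ 0]) simp
  next
    case False
    define u where "u = (r / norm y) *\<^sub>R y"
    have nu: "norm u = r" using False r by (simp add: u_def)
    then have "x0 + u \<in> closure (V n)" "x0 - u \<in> closure (V n)"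
      using ball by (auto simp: dist_norm)
    then obtain a b where a: "a \<in> V n" "dist a (x0 + u) < r / 2"
      and b: "b \<in> V n" "dist b (x0 - u) < r / 2"
      using r unfolding closure_approachable by (meson half_gt_zero)
    define w where "w = (1/2) *\<^sub>R (a - b)"
    have fw: "norm (f w) \<le> real n"
    proof -
      have "norm (f a - f b) \<le> real n + real n"
        using a b norm_triangle_ineq4[of "f a" "f b"] by (simp add: V_def)
      then show ?thesis
        by (simp add: w_def linear_diff[OF lin] linear_cmul[OF lin])
    qed
    \<comment> \<open>The centre \<open>x0\<close> cancels in the half difference, which approximates \<open>u\<close>.\<close>
    have "u - w = (1/2) *\<^sub>R (((x0 + u) - a) - ((x0 - u) - b))"
      by (simp add: w_def algebra_simps flip: scaleR_add_left)
    moreover have "norm (((x0 + u) - a) - ((x0 - u) - b)) \<le> r / 2 + r / 2"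
      using a(2) b(2) norm_triangle_ineq4[of "(x0 + u) - a" "(x0 - u) - b"]
      by (simp add: dist_norm norm_minus_commute)
    ultimately have uw: "norm (u - w) \<le> r / 2" by simp
    define v where "v = (norm y / r) *\<^sub>R w"
    have y: "y = (norm y / r) *\<^sub>R u" using False r by (simp add: u_def)
    have "y - v = (norm y / r) *\<^sub>R (u - w)"
      unfolding v_def by (subst y) (simp add: scaleR_diff_right)
    then have "norm (y - v) = norm y / r * norm (u - w)" using r by simp
    also have "\<dots> \<le> norm y / r * (r / 2)"
      using uw r by (intro mult_left_mono) auto
    finally have "norm (y - v) \<le> norm y / 2" using r by simp
    moreover have "norm (f v) = norm y / r * norm (f w)"
      using r by (simp add: v_def linear_cmul[OF lin])
    then have "norm (f v) \<le> real n / r * norm y"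
      using mult_left_mono[OF fw, of "norm y / r"] r by (simp add: mult.commute)
    ultimately show ?thesis by blast
  qed
  define c where "c = real n / r"
  have c: "c \<ge> 0" using r by (simp add: c_def)
  from approx obtain v where v1: "\<And>y. norm (f (v y)) \<le> c * norm y"
    and v2: "\<And>y. norm (y - v y) \<le> norm y / 2"
    unfolding c_def by metis
  have "norm (f y) \<le> norm y * (2 * c)" for y
  proof -
    define Y where "Y = (\<lambda>k. ((\<lambda>y. y - v y) ^^ k) y)"
    have Y0: "Y 0 = y" and YS: "\<And>k. Y (Suc k) = Y k - v (Y k)" by (simp_all add: Y_def)
    have nY: "norm (Y k) \<le> norm y * (1/2) ^ k" for k
    proof (induction k)
      case (Suc k)
      then show ?case using v2[of "Y k"] by (simp add: YS)
    qed (simp add: Y0)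
    have geo: "summable (\<lambda>k. c * norm y * (1/2) ^ k)"
      by (intro summable_mult summable_geometric) simp
    have term_le: "norm (f (v (Y k))) \<le> c * norm y * (1/2) ^ k" for k
      using v1[of "Y k"] mult_left_mono[OF nY c, of k] by (simp add: mult.assoc)
    have sm: "summable (\<lambda>k. norm (f (v (Y k))))"
      by (rule summable_comparison_test'[OF geo, of 0]) (use term_le in auto)
    have partial: "f (y - Y k) = (\<Sum>i<k. f (v (Y i)))" for k
    proof (induction k)
      case 0
      then show ?case by (simp add: Y0 linear_0[OF lin])
    next
      case (Suc k)
      have "y - Y (Suc k) = (y - Y k) + v (Y k)" by (simp add: YS)
      then show ?case using Suc by (simp only: linear_add[OF lin] sum.lessThan_Suc)
    qed
    have "Y \<longlonglongrightarrow> 0"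
    proof (rule Lim_null_comparison)
      show "\<forall>\<^sub>F k in sequentially. norm (Y k) \<le> norm y * (1/2) ^ k" using nY by simp
      show "(\<lambda>k. norm y * (1/2) ^ k) \<longlonglongrightarrow> 0"
        by (intro tendsto_mult_right_zero LIMSEQ_realpow_zero) auto
    qed
    then have "(\<lambda>k. y - Y k) \<longlonglongrightarrow> y" using tendsto_diff[OF tendsto_const, of Y 0 _ y] by simp
    moreover have "(\<lambda>k. f (y - Y k)) \<longlonglongrightarrow> (\<Sum>k. f (v (Y k)))"
      unfolding partial by (intro summable_LIMSEQ summable_norm_cancel[OF sm])
    ultimately have "f y = (\<Sum>k. f (v (Y k)))" by (rule graph)
    then have "norm (f y) \<le> (\<Sum>k. norm (f (v (Y k))))" using summable_norm[OF sm] by simp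
    also have "\<dots> \<le> (\<Sum>k. c * norm y * (1/2) ^ k)" by (intro suminf_le term_le sm geo)
    also have "\<dots> = norm y * (2 * c)"
      by (subst suminf_mult) (auto intro: summable_geometric simp: suminf_geometric)
    finally show ?thesis .
  qed
  then show ?thesis
    using lin unfolding bounded_linear_def bounded_linear_axioms_def by blast
qed

text \<open>With a right inverse \<open>R\<close> of \<open>L\<close>, the equation \<open>L x + D x = y\<close> holds at a fixed point of
  \<open>x \<mapsto> R (y - D x)\<close>, which is a contraction with constant \<open>C d\<close>.\<close>

lemma surj_perturbation:
  fixes L D :: "'a::banach \<Rightarrow> 'a"
  assumes "linear L" "surj L" and below: "\<And>x. norm x \<le> C * norm (L x)"
    and "linear D" and small: "\<And>x. norm (D x) \<le> d * norm x"
    and "0 \<le> C" "0 \<le> d" "C * d < 1"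
  shows "surj (\<lambda>x. L x + D x)"
proof -
  obtain R where R: "\<And>y. L (R y) = y" using \<open>surj L\<close> by (metis surjD)
  have "\<exists>x. y = L x + D x" for y
  proof -
    have "\<exists>!x. R (y - D x) = x"
    proof (rule banach_fix_type[where c = "C * d"], goal_cases)
      case 3
      show ?case
      proof (intro allI)
        fix a b
        have "norm (R (y - D a) - R (y - D b)) \<le> C * norm (L (R (y - D a) - R (y - D b)))"
          by (rule below)
        also have "L (R (y - D a) - R (y - D b)) = D (b - a)"
          by (simp add: linear_diff[OF \<open>linear L\<close>] linear_diff[OF \<open>linear D\<close>] R)
        also have "C * norm (D (b - a)) \<le> C * (d * norm (b - a))"
          by (intro mult_left_mono small assms)
        finally show "dist (R (y - D a)) (R (y - D b)) \<le> C * d * dist a b"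
          by (simp add: dist_norm norm_minus_commute mult.assoc)
      qed
    qed (use assms in auto)
    then obtain x where "R (y - D x) = x" by blast
    then have "L x = y - D x" using R by metis
    then show ?thesis by (metis diff_add_cancel)
  qed
  then show ?thesis by blast
qed

section \<open>The inner product\<close>

lemma norm_star: "norm (star x) = norm (x::'a::cstar_algebra)"
proof -
  have le: "norm y \<le> norm (star y)" for y :: 'a
  proof (cases "norm y = 0")
    case False
    have "norm y * norm y \<le> norm (star y) * norm y"
      using norm_mult_ineq[of "star y" y] by (simp add: cstar_identity power2_eq_square)
    then show ?thesis using False by simp
  qed simp
  show ?thesis using le[of x] le[of "star x"] by (simp add: star_star)
qed

lemma scaleC_minus1: "(-1) *\<^sub>C (x::'a::complex_vector) = - x"
  using scaleR_scaleC[of "-1" x] by simp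

lemma scaleC_diff_right: "c *\<^sub>C (x - y) = c *\<^sub>C x - c *\<^sub>C (y::'a::complex_vector)"
  using scaleC_add_right[of c "x - y" y] by simp

lemma scaleC_minus_left: "(- c) *\<^sub>C x = - (c *\<^sub>C (x::'a::complex_vector))"
  using scaleC_scaleC[of "-1" c x] by (simp add: scaleC_minus1)

context hilbert_cstar_module
begin

lemma ip_add_left: "ip (x + y) z = ip x z + ip y z"
  using ip_add_right[of z x y] by (metis ip_star star_add)

lemma ip_scaleC_left: "ip (c *\<^sub>C x) y = cnj c *\<^sub>C ip x y"
  using ip_scaleC_right[of y c x] by (metis ip_star star_scaleC)

lemma norm_power2_ip: "norm (ip x x) = (norm x)\<^sup>2"
  using norm_ip[of x] by simp

lemma norm_scaleC_module: "norm (c *\<^sub>C x) = cmod c * norm (x::'e)"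
  by (simp add: norm_ip ip_scaleC_left ip_scaleC_right norm_scaleC real_sqrt_mult
      real_sqrt_mult_self flip: mult.assoc)

lemma ip_polarization:
  "4 *\<^sub>R ip x y = (ip (x + y) (x + y) - ip (x - y) (x - y))
     - \<i> *\<^sub>C (ip (x + \<i> *\<^sub>C y) (x + \<i> *\<^sub>C y) - ip (x - \<i> *\<^sub>C y) (x - \<i> *\<^sub>C y))"
  (is "_ = ?A - \<i> *\<^sub>C ?B")
proof -
  have diff: "ip (x + z) (x + z) - ip (x - z) (x - z) = 2 *\<^sub>R (ip x z + ip z x)" for z
  proof -
    have m: "x - z = x + (-1) *\<^sub>C z" by (simp add: scaleC_minus1)
    show ?thesis
      unfolding m
      by (simp only: ip_add_left ip_add_right ip_scaleC_left ip_scaleC_right)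
        (simp add: scaleC_minus1 scaleR_2)
  qed
  have "?B = 2 *\<^sub>R \<i> *\<^sub>C (ip x y - ip y x)"
    unfolding diff ip_scaleC_left ip_scaleC_right
    by (simp add: scaleC_minus_left scaleC_diff_right)
  then have "\<i> *\<^sub>C ?B = (\<i> * (2 * \<i>)) *\<^sub>C (ip x y - ip y x)"
    by (simp only: scaleR_scaleC scaleC_scaleC) simp
  also have "\<dots> = (-2) *\<^sub>R (ip x y - ip y x)"
    unfolding scaleR_scaleC by (rule arg_cong[where f = "\<lambda>c. c *\<^sub>C _"]) simp
  finally have "\<i> *\<^sub>C ?B = 2 *\<^sub>R (ip y x - ip x y)"
    by (simp add: algebra_simps)
  then show ?thesis
    by (simp only: diff[of y])
      (simp add: scaleR_diff_right scaleR_add_right flip: scaleR_add_left)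
qed

text \<open>For unit vectors each of the four inner squares in the polarization identity has norm at most
  \<open>(1 + 1)\<^sup>2\<close>, by the triangle inequality, which gives the factor 4 in place of the optimal 1.\<close>

lemma norm_ip_le: "norm (ip x y) \<le> 4 * (norm x * norm y)"
proof -
  have unit: "norm (ip u v) \<le> 4" if "norm u = 1" "norm v = 1" for u v
  proof -
    have q: "norm (ip (u + z) (u + z) - ip (u - z) (u - z)) \<le> 8" if "norm z = 1" for z
    proof -
      have "norm (u + z) \<le> 2" "norm (u - z) \<le> 2"
        using norm_triangle_ineq[of u z] norm_triangle_ineq4[of u z] that \<open>norm u = 1\<close> by auto
      then have "(norm (u + z))\<^sup>2 \<le> 4" "(norm (u - z))\<^sup>2 \<le> 4"
        using power_mono[of "norm (u + z)" 2 2] power_mono[of "norm (u - z)" 2 2] by auto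
      then show ?thesis
        using norm_triangle_ineq4[of "ip (u + z) (u + z)" "ip (u - z) (u - z)"]
        by (simp add: norm_power2_ip)
    qed
    have "norm (4 *\<^sub>R ip u v) \<le> 8 + 8"
      unfolding ip_polarization
      by (intro norm_triangle_le_diff add_mono q)
        (use q[of "\<i> *\<^sub>C v"] that in \<open>simp_all add: norm_scaleC norm_scaleC_module\<close>)
    then show ?thesis by simp
  qed
  have s: "ip (a *\<^sub>R u) (b *\<^sub>R v) = (a * b) *\<^sub>R ip u v" for a b u v
    by (simp add: scaleR_scaleC ip_scaleC_left ip_scaleC_right scaleC_scaleC mult.commute)
  show ?thesis
  proof (cases "x = 0 \<or> y = 0")
    case True
    then show ?thesis using s[of 0 x 1 y] s[of 1 x 0 y] by auto
  next
    case False
    then have "norm (ip (inverse (norm x) *\<^sub>R x) (inverse (norm y) *\<^sub>R y)) \<le> 4"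
      by (intro unit) auto
    then show ?thesis
      using False by (simp add: s divide_simps mult.commute)
  qed
qed

lemma bounded_bilinear_ip: "bounded_bilinear ip"
proof
  show "\<exists>K. \<forall>a b. norm (ip a b) \<le> norm a * norm b * K"
    using norm_ip_le by (metis mult.commute)
qed (simp_all add: ip_add_left ip_add_right scaleR_scaleC ip_scaleC_left ip_scaleC_right)

lemmas ip_diff_left = bounded_bilinear.diff_left[OF bounded_bilinear_ip]
lemmas ip_diff_right = bounded_bilinear.diff_right[OF bounded_bilinear_ip]
lemmas ip_zero_left = bounded_bilinear.zero_left[OF bounded_bilinear_ip]
lemmas ip_zero_right = bounded_bilinear.zero_right[OF bounded_bilinear_ip]

lemma ip_eq_0_commute: "ip x y = 0 \<longleftrightarrow> ip y x = 0"
proof -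
  have "ip v u = 0" if "ip u v = 0" for u v
    using that norm_star[of "ip u v"] ip_star[of v u] by simp
  then show ?thesis by blast
qed

lemma ip_right_cancel:
  assumes "\<And>y. ip u y = ip v y" shows "u = v"
  using assms[of "u - v"] ip_definite[of "u - v"] by (simp add: ip_diff_left)

lemma ip_left_cancel:
  assumes "\<And>y. ip y u = ip y v" shows "u = v"
  using assms[of "u - v"] ip_definite[of "u - v"] by (simp add: ip_diff_right)

section \<open>Surjectivity of self-adjoint operators\<close>

text \<open>The inner products of \<open>T x\<close> with all vectors determine it and, through the adjoint, depend linearly
  and continuously on \<open>x\<close>. This gives linearity and a closed graph.\<close>

lemma adjoint_pair_bounded_linear:
  assumes adj: "\<And>x y. ip (T x) y = ip x (S y)"
  shows "bounded_linear T"
proof (rule closed_graph_bounded_linear)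
  show "linear T"
    by (intro linearI ip_right_cancel)
      (simp_all add: adj ip_add_left scaleR_scaleC ip_scaleC_left)
next
  fix X x z
  assume X: "X \<longlonglongrightarrow> x" and TX: "(\<lambda>n. T (X n)) \<longlonglongrightarrow> z"
  show "T x = z"
  proof (rule ip_right_cancel)
    fix y
    have "(\<lambda>n. ip (T (X n)) y) \<longlonglongrightarrow> ip z y"
      by (intro bounded_bilinear.tendsto[OF bounded_bilinear_ip] TX tendsto_const)
    moreover have "(\<lambda>n. ip (T (X n)) y) \<longlonglongrightarrow> ip (T x) y"
      unfolding adj by (intro bounded_bilinear.tendsto[OF bounded_bilinear_ip] X tendsto_const)
    ultimately show "ip (T x) y = ip z y" by (rule LIMSEQ_unique[symmetric])
  qed
qed

lemma adjoint_pair_swap: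
  assumes "\<And>x y. ip (T x) y = ip x (S y)"
  shows "ip (S x) y = ip x (T y)"
  by (metis assms ip_star)

text \<open>Self-adjointness makes the cross terms in the inner squares of \<open>S x + i r x\<close> and \<open>S x - i r x\<close>
  cancel, so these two vectors have equal norms, and \<open>S x\<close> is half their sum.\<close>

lemma selfadjoint_norm_le_add_imaginary:
  assumes sa: "\<And>x y. ip (S x) y = ip x (S y)"
  shows "norm (S x) \<le> norm (S x + r *\<^sub>R \<i> *\<^sub>C x)"
proof -
  let ?w = "r *\<^sub>R \<i> *\<^sub>C x"
  have cross: "ip (S x) ?w + ip ?w (S x) = 0"
    by (simp add: scaleR_scaleC ip_scaleC_left ip_scaleC_right scaleC_scaleC sa
        flip: scaleC_add_left) (metis pth_1 scaleR_scaleC scaleR_zero_left of_real_0)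
  have "ip (S x + ?w) (S x + ?w) = ip (S x) (S x) + ip ?w ?w + (ip (S x) ?w + ip ?w (S x))"
    and "ip (S x - ?w) (S x - ?w) = ip (S x) (S x) + ip ?w ?w - (ip (S x) ?w + ip ?w (S x))"
    by (simp_all add: ip_add_left ip_add_right ip_diff_left ip_diff_right)
  then have eq: "norm (S x - ?w) = norm (S x + ?w)"
    unfolding norm_ip by (simp only: cross) simp
  have "2 *\<^sub>R S x = (S x + ?w) + (S x - ?w)" by (simp add: scaleR_2)
  then have "norm (2 *\<^sub>R S x) \<le> 2 * norm (S x + ?w)"
    using norm_triangle_ineq[of "S x + ?w" "S x - ?w"] eq by simp
  then show ?thesis by simp
qed

text \<open>This is the method of continuity along \<open>S + i t\<close>. For \<open>t\<close> above twice a bound of \<open>S\<close> the operator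
  is a small perturbation of the invertible \<open>i t\<close>. The lower bound is the same for all \<open>t\<close>, so a
  fixed step width \<open>d\<close> carries surjectivity from \<open>t + d\<close> to \<open>t\<close>, and finitely many steps reach \<open>0\<close>.\<close>

lemma selfadjoint_bounded_below_surj:
  assumes sa: "\<And>x y. ip (S x) y = ip x (S y)"
    and below: "\<And>x. norm x \<le> C * norm (S x)"
  shows "surj S"
proof -
  \<comment> \<open>On the zero module \<open>C\<close> may be negative, hence the passage to a positive constant.\<close>
  define c where "c = \<bar>C\<bar> + 1"
  have c: "c > 0" "norm x \<le> c * norm (S x)" for x
  proof -
    have "C * norm (S x) \<le> c * norm (S x)" by (intro mult_right_mono) (auto simp: c_def)
    then show "norm x \<le> c * norm (S x)" using below[of x] by simp
  qed (simp add: c_def)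
  define d where "d = 1 / (2 * c)"
  have d: "d > 0" "c * d < 1" using c(1) by (simp_all add: d_def)
  define J where "J = (\<lambda>(r::real) x::'e. r *\<^sub>R \<i> *\<^sub>C x)"
  have linS: "linear S"
    using adjoint_pair_bounded_linear[OF sa] by (rule bounded_linear.linear)
  have linJ: "linear (J r)" for r
    by (intro linearI) (simp_all add: J_def scaleR_scaleC scaleC_scaleC scaleC_add_right mult_ac)
  have normJ: "norm (J r x) = \<bar>r\<bar> * norm x" for r x by (simp add: J_def norm_scaleC_module)
  have belowJ: "norm x \<le> c * norm (S x + J r x)" for r x
    unfolding J_def using c(1)
    by (intro order_trans[OF c(2)] mult_left_mono selfadjoint_norm_le_add_imaginary sa) simp
  obtain B where B: "B > 0" "\<And>x. norm (S x) \<le> B * norm x"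
    using bounded_linear.pos_bounded[OF adjoint_pair_bounded_linear[OF sa]]
    by (metis mult.commute)
  obtain N :: nat where N: "2 * B / d < real N" using reals_Archimedean2 by blast
  have step: "surj (\<lambda>x. S x + J (real n * d) x)" if "n \<le> N" for n
    using that
  proof (induction rule: inc_induct)
    case base
    let ?r = "real N * d"
    have r: "?r > 2 * B" using N d(1) by (simp add: field_simps)
    have inv: "J s (- (1 / s) *\<^sub>R \<i> *\<^sub>C y) = y" if "s \<noteq> 0" for s y
      using that by (simp add: J_def scaleR_scaleC scaleC_scaleC scaleC_one)
    have "?r \<noteq> 0" using r B(1) by linarith
    then have "surj (J ?r)" by (intro surjI) (rule inv)
    then have "surj (\<lambda>x. J ?r x + S x)"
      by (rule surj_perturbation[OF linJ _ _ linS B(2), of _ "1 / ?r"])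
        (use r B(1) in \<open>auto simp: normJ field_simps\<close>)
    then show ?case by (simp add: add.commute)
  next
    case (step n)
    have "surj (\<lambda>x. (S x + J (real (Suc n) * d) x) + J (- d) x)"
      by (rule surj_perturbation[OF _ step.IH belowJ linJ, of _ d])
        (use d c in \<open>auto simp: normJ intro!: linear_compose_add linS linJ\<close>)
    moreover have "(S x + J (real (Suc n) * d) x) + J (- d) x = S x + J (real n * d) x" for x
      by (simp add: J_def algebra_simps)
    ultimately show ?case by (simp only:)
  qed
  show ?thesis using step[of 0] by (simp add: J_def)
qed

section \<open>Orthogonally complemented submodules\<close>

lemma submodule_diff:
  assumes "submodule act M" "x \<in> M" "y \<in> M" shows "x - y \<in> M"
proof -
  have "x + (-1) *\<^sub>C y \<in> M" using assms unfolding submodule_def by blast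
  then show ?thesis by (simp add: scaleC_minus1)
qed

lemma submodule_scaleR:
  assumes "submodule act M" "x \<in> M" shows "r *\<^sub>R x \<in> M"
  using assms by (simp add: submodule_def scaleR_scaleC)

lemma submodule_set_plus:
  assumes "submodule act H" "submodule act K" shows "submodule act (H + K)"
  unfolding submodule_def
proof (intro conjI ballI allI)
  show "0 \<in> H + K"
    using assms set_plus_intro[of 0 H 0 K] by (simp add: submodule_def)
  show "x + y \<in> H + K" if "x \<in> H + K" "y \<in> H + K" for x y
  proof -
    from that obtain a b c d where "x = a + b" "y = c + d" "a \<in> H" "b \<in> K" "c \<in> H" "d \<in> K"
      by (elim set_plus_elim) blast
    then have "x + y = (a + c) + (b + d)" "a + c \<in> H" "b + d \<in> K"
      using assms unfolding submodule_def by simp_all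
    then show ?thesis by (metis set_plus_intro)
  qed
  show "c *\<^sub>C x \<in> H + K" if "x \<in> H + K" for c x
  proof -
    from that obtain h k where x: "x = h + k" and "h \<in> H" "k \<in> K" by (rule set_plus_elim)
    then show ?thesis
      unfolding x scaleC_add_right using assms unfolding submodule_def by (intro set_plus_intro) simp_all
  qed
  show "act x a \<in> H + K" if "x \<in> H + K" for a x
  proof -
    from that obtain h k where x: "x = h + k" and "h \<in> H" "k \<in> K" by (rule set_plus_elim)
    then show ?thesis
      unfolding x act_add_left using assms unfolding submodule_def by (intro set_plus_intro) simp_all
  qed
qed

lemma orthogonal_projection_exists:
  assumes "submodule act M" "orth_complemented ip M"
  obtains p where "\<And>x y. ip (p x) y = ip x (p y)" "\<And>x. p x \<in> M" "\<And>x. x \<in> M \<Longrightarrow> p x = x"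
proof -
  have "\<exists>y. y \<in> M \<and> x - y \<in> orth_compl ip M" for x
  proof -
    have "x \<in> M + orth_compl ip M" using assms(2) by (simp add: orth_complemented_def)
    then show ?thesis by (auto elim!: set_plus_elim)
  qed
  then obtain p where pM: "\<And>x. p x \<in> M" and po: "\<And>x. x - p x \<in> orth_compl ip M" by metis
  have o: "ip (x - p x) y = 0" "ip y (x - p x) = 0" if "y \<in> M" for x y
    using po[of x] that ip_eq_0_commute by (auto simp: orth_compl_def)
  show ?thesis
  proof (rule that)
    show "ip (p x) y = ip x (p y)" for x y
      using o(1)[OF pM, of x y] o(2)[OF pM, of x y]
      by (simp add: ip_diff_left ip_diff_right)
    show "p x = x" if "x \<in> M" for x
      using ip_definite[of "x - p x"] o(1)[of "x - p x" x] submodule_diff[OF assms(1) that pM]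
      by simp
  qed (rule pM)
qed

text \<open>The operator \<open>W = J + J' - 1\<close> is bounded below because it controls both parts of
  \<open>x = J x + (1 - J) x\<close>: from \<open>J' W = J' J\<close> and \<open>(J' - 1) W = (1 - J') (1 - J)\<close> the inner squares of
  \<open>J x\<close> and \<open>(1 - J) x\<close> are the inner products of \<open>x\<close> with \<open>J' W x\<close> and \<open>(J' - 1) W x\<close>. Being
  self-adjoint, \<open>W\<close> is then surjective.\<close>

lemma range_idempotent_orth_complemented:
  assumes adj: "\<And>x y. ip (J x) y = ip x (J' y)" and idem: "\<And>x. J (J x) = J x"
  shows "orth_complemented ip (range J)"
proof -
  note adj' = adjoint_pair_swap[OF adj]
  interpret J: bounded_linear J by (rule adjoint_pair_bounded_linear[OF adj])
  interpret J': bounded_linear J' by (rule adjoint_pair_bounded_linear[OF adj'])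
  have idem': "J' (J' x) = J' x" for x
    by (rule ip_left_cancel) (simp add: idem flip: adj)
  define W where "W = (\<lambda>x. J x + J' x - x)"
  have saW: "ip (W x) y = ip x (W y)" for x y
    by (simp add: W_def ip_diff_left ip_diff_right ip_add_left ip_add_right adj adj' add.commute)
  obtain B where B: "B > 0" "\<And>x. norm (J' x) \<le> norm x * B"
    using J'.pos_bounded by blast
  have J'_W: "J' (W x) = J' (J x)" for x
    by (simp add: W_def J'.add J'.diff idem')
  have "norm x \<le> 16 * (1 + B) * norm (W x)" for x
  proof -
    let ?z = "x - J x"
    define m where "m = 4 * (1 + B) * norm x * norm (W x)"
    have "ip (J x) (J x) = ip x (J' (W x))" by (simp add: adj J'_W)
    then have "(norm (J x))\<^sup>2 = norm (ip x (J' (W x)))" by (simp flip: norm_power2_ip)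
    also have "\<dots> \<le> 4 * (norm x * norm (J' (W x)))" by (rule norm_ip_le)
    also have "\<dots> \<le> 4 * (norm x * (norm (W x) * B))" by (intro mult_left_mono B) auto
    also have "\<dots> \<le> m" using B(1) by (simp add: m_def algebra_simps)
    finally have 1: "(norm (J x))\<^sup>2 \<le> m" .
    have "ip ?z ?z = ip x (?z - J' ?z)"
      unfolding ip_diff_left[of x] adj by (rule ip_diff_right[symmetric])
    also have "?z - J' ?z = J' (W x) - W x"
      by (simp add: J'_W J'.diff) (simp add: W_def)
    finally have "(norm ?z)\<^sup>2 = norm (ip x (J' (W x) - W x))" by (simp flip: norm_power2_ip)
    also have "\<dots> \<le> 4 * (norm x * norm (J' (W x) - W x))" by (rule norm_ip_le)
    also have "\<dots> \<le> 4 * (norm x * ((1 + B) * norm (W x)))"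
      using norm_triangle_ineq4[of "J' (W x)" "W x"] B(2)[of "W x"]
      by (intro mult_left_mono) (simp_all add: algebra_simps)
    also have "\<dots> = m" by (simp add: m_def)
    finally have 2: "(norm ?z)\<^sup>2 \<le> m" .
    have "norm x \<le> norm (J x) + norm ?z" using norm_triangle_ineq[of "J x" ?z] by simp
    then have "(norm x)\<^sup>2 \<le> (norm (J x) + norm ?z)\<^sup>2" by (intro power_mono) auto
    also have "\<dots> \<le> 2 * (norm (J x))\<^sup>2 + 2 * (norm ?z)\<^sup>2"
      using zero_le_power2[of "norm (J x) - norm ?z"] by (simp add: power2_sum power2_diff)
    also have "\<dots> \<le> 4 * m" using 1 2 by simp
    finally have le: "norm x * norm x \<le> norm x * (16 * (1 + B) * norm (W x))"
      by (simp add: m_def power2_eq_square algebra_simps)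
    show ?thesis
    proof (cases "x = 0")
      case False
      then have "0 < norm x" by simp
      with le show ?thesis by (rule mult_left_le_imp_le)
    qed (use B(1) in simp)
  qed
  then have surjW: "surj W" by (rule selfadjoint_bounded_below_surj[OF saW])
  have "x \<in> range J + orth_compl ip (range J)" for x
  proof -
    obtain y where "x = W y" using surjW by (metis surjD)
    then have x: "x = J y + (J' y - y)" by (simp add: W_def)
    have "J' y - y \<in> orth_compl ip (range J)"
      by (auto simp: orth_compl_def ip_diff_left adj' idem)
    then show ?thesis unfolding x by (intro set_plus_intro rangeI)
  qed
  moreover have "range J \<inter> orth_compl ip (range J) = {0}"
  proof -
    have "J y = 0" if "J y \<in> orth_compl ip (range J)" for y
      using that by (intro ip_definite) (simp add: orth_compl_def)
    moreover have "0 \<in> range J" by (rule range_eqI[of _ _ 0]) (simp add: J.zero)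
    moreover have "0 \<in> orth_compl ip (range J)" by (simp add: orth_compl_def ip_zero_left)
    ultimately show ?thesis by blast
  qed
  ultimately show ?thesis unfolding orth_complemented_def by blast
qed

section \<open>Separated pairs and idempotents\<close>

text \<open>The component maps \<open>f\<close> and \<open>g\<close> of the decomposition along \<open>H\<close>, \<open>K\<close> and the complement of \<open>H + K\<close>
  have closed graphs because \<open>H\<close> and \<open>K\<close> are closed. They satisfy \<open>f S = p\<close> and \<open>g S = q\<close> for the
  self-adjoint operator \<open>S = p + q + (1 - r)\<close>, so their boundedness makes \<open>S\<close> bounded below, and
  invertibility of \<open>S\<close> in turn yields their adjoints.\<close>

lemma separated_pair_component_projections:
  assumes H: "closed_submodule act H" "orth_complemented ip H"
    and K: "closed_submodule act K" "orth_complemented ip K"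
    and sep: "H \<inter> K = {0}" "orth_complemented ip (H + K)"
  obtains f g where "adjointable ip f" "adjointable ip g"
    "\<And>x. f x \<in> H" "\<And>x. g x \<in> K"
    "\<And>h. h \<in> H \<Longrightarrow> f h = h \<and> g h = 0" "\<And>k. k \<in> K \<Longrightarrow> f k = 0 \<and> g k = k"
proof -
  have subH: "submodule act H" and subK: "submodule act K" and closedH: "closed H"
    and closedK: "closed K"
    using H K by (auto simp: closed_submodule_def)
  have subHK: "submodule act (H + K)" by (rule submodule_set_plus[OF subH subK])
  have H0: "0 \<in> H" and K0: "0 \<in> K" using subH subK by (auto simp: submodule_def)
  obtain p where p: "\<And>x y. ip (p x) y = ip x (p y)" "\<And>x. p x \<in> H" "\<And>x. x \<in> H \<Longrightarrow> p x = x"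
    using orthogonal_projection_exists[OF subH H(2)] by metis
  obtain q where q: "\<And>x y. ip (q x) y = ip x (q y)" "\<And>x. q x \<in> K" "\<And>x. x \<in> K \<Longrightarrow> q x = x"
    using orthogonal_projection_exists[OF subK K(2)] by metis
  obtain r where r: "\<And>x y. ip (r x) y = ip x (r y)" "\<And>x. r x \<in> H + K"
      "\<And>x. x \<in> H + K \<Longrightarrow> r x = x"
    using orthogonal_projection_exists[OF subHK sep(2)] by metis
  interpret r: bounded_linear r by (rule adjoint_pair_bounded_linear[OF r(1)])
  have "\<exists>h. h \<in> H \<and> r x - h \<in> K" for x
    using r(2)[of x] by (auto elim!: set_plus_elim)
  then obtain f where fH: "\<And>x. f x \<in> H" and fK: "\<And>x. r x - f x \<in> K" by metis
  define g where "g = (\<lambda>x. r x - f x)"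
  have gK: "g x \<in> K" for x by (simp add: g_def fK)
  have f_eq: "f x = h" if "h \<in> H" "r x - h \<in> K" for x h
  proof -
    have "f x - h \<in> H" by (rule submodule_diff[OF subH fH that(1)])
    moreover have "f x - h \<in> K" using submodule_diff[OF subK that(2) fK[of x]] by simp
    ultimately have "f x - h \<in> {0}" unfolding sep(1)[symmetric] by (rule IntI)
    then show ?thesis by simp
  qed
  have fg: "f (h + k) = h" "g (h + k) = k" if "h \<in> H" "k \<in> K" for h k
  proof -
    have "r (h + k) = h + k" using that by (intro r(3) set_plus_intro)
    then show "f (h + k) = h" using that by (intro f_eq) auto
    then show "g (h + k) = k" using \<open>r (h + k) = h + k\<close> by (simp add: g_def)
  qed
  have linf: "linear f"
  proof (rule linearI)
    show "f (x + y) = f x + f y" for x y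
    proof (rule f_eq)
      show "f x + f y \<in> H" using fH subH by (simp add: submodule_def)
      have "r (x + y) - (f x + f y) = g x + g y" by (simp add: g_def r.add)
      then show "r (x + y) - (f x + f y) \<in> K" using gK subK by (simp add: submodule_def)
    qed
    show "f (c *\<^sub>R x) = c *\<^sub>R f x" for c x
    proof (rule f_eq)
      show "c *\<^sub>R f x \<in> H" by (rule submodule_scaleR[OF subH fH])
      have "r (c *\<^sub>R x) - c *\<^sub>R f x = c *\<^sub>R g x" by (simp add: g_def r.scaleR scaleR_diff_right)
      then show "r (c *\<^sub>R x) - c *\<^sub>R f x \<in> K" by (simp add: submodule_scaleR[OF subK gK])
    qed
  qed
  interpret f: bounded_linear f
  proof (rule closed_graph_bounded_linear[OF linf])
    fix X x z
    assume X: "X \<longlonglongrightarrow> x" and fX: "(\<lambda>n. f (X n)) \<longlonglongrightarrow> z"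
    have "(\<lambda>n. r (X n) - f (X n)) \<longlonglongrightarrow> r x - z" by (intro tendsto_diff r.tendsto X fX)
    then have "r x - z \<in> K" by (rule closed_sequentially[OF closedK, rotated]) (rule fK)
    moreover have "z \<in> H" using closed_sequentially[OF closedH _ fX] fH by blast
    ultimately show "f x = z" by (intro f_eq)
  qed
  have "bounded_linear g" unfolding g_def
    by (intro bounded_linear_sub r.bounded_linear_axioms f.bounded_linear_axioms)
  then interpret g: bounded_linear g .

  define S where "S = (\<lambda>x. p x + q x + (x - r x))"
  have saS: "ip (S x) y = ip x (S y)" for x y
    by (simp add: S_def ip_diff_left ip_diff_right ip_add_left ip_add_right p q r)
  have r_ortho: "r (x - r x) = 0" for x using r(2,3) by (simp add: r.diff)
  have f_ortho: "f (x - r x) = 0" for x using H0 K0 by (intro f_eq) (simp_all add: r_ortho)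
  have g_ortho: "g (x - r x) = 0" for x by (simp add: g_def f_ortho r_ortho)
  have fS: "f (S x) = p x" and gS: "g (S x) = q x" for x
    using fg[OF p(2) q(2)]
    by (simp_all only: S_def f.add[of "p x + q x"] g.add[of "p x + q x"] f_ortho g_ortho
        add_0_right)
  have rS: "S x - r (S x) = x - r x" for x
  proof -
    have "r (S x) = f (S x) + g (S x)" by (simp add: g_def)
    then show ?thesis by (simp only: fS gS) (simp add: S_def)
  qed

  obtain Bf where Bf: "Bf > 0" "\<And>x. norm (f x) \<le> norm x * Bf" using f.pos_bounded by blast
  obtain Bg where Bg: "Bg > 0" "\<And>x. norm (g x) \<le> norm x * Bg" using g.pos_bounded by blast
  obtain Br where Br: "Br > 0" "\<And>x. norm (r x) \<le> norm x * Br" using r.pos_bounded by blast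
  define C where "C = 4 * (Bf * Bf + Bg * Bg + (1 + Br) * (1 + Br))"
  have "norm x \<le> C * norm (S x)" for x
  proof -
    have Br1: "norm (y - r y) \<le> norm y * (1 + Br)" for y
      using norm_triangle_ineq4[of y "r y"] Br(2)[of y] by (simp add: algebra_simps)
    have est: "norm (ip a b) \<le> norm (S x) * norm x * (4 * (c * c))"
      if "norm a \<le> norm (S x) * c" "norm b \<le> norm x * c" for a b c
    proof -
      have "norm a * norm b \<le> (norm (S x) * c) * (norm x * c)"
        by (intro mult_mono that) (use that norm_ge_zero order_trans in blast)+
      then show ?thesis using norm_ip_le[of a b] by (simp add: algebra_simps)
    qed
    \<comment> \<open>Each component of \<open>x\<close> lies in the range of a projection, which may be moved to the left
      argument; there it turns into a component of \<open>S x\<close>.\<close>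
    have "ip x x = ip x (f x + g x + (x - r x))" by (simp add: g_def)
    also have "\<dots> = ip (p x) (f x) + ip (q x) (g x) + ip (x - r x) (x - r x)"
    proof -
      have "ip x (f x) = ip (p x) (f x)" "ip x (g x) = ip (q x) (g x)"
        by (simp_all add: p q fH gK)
      moreover have "ip (r x) (x - r x) = 0" by (simp only: r(1) r_ortho ip_zero_right)
      then have "ip x (x - r x) = ip (x - r x) (x - r x)" by (simp add: ip_diff_left)
      ultimately show ?thesis by (simp only: ip_add_right)
    qed
    also have "\<dots> = ip (f (S x)) (f x) + ip (g (S x)) (g x) + ip (S x - r (S x)) (x - r x)"
      by (simp only: fS gS rS)
    finally have "(norm x)\<^sup>2 = norm \<dots>" by (metis norm_power2_ip)
    also have "\<dots> \<le> norm (S x) * norm x * (4 * (Bf * Bf)) + norm (S x) * norm x * (4 * (Bg * Bg))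
        + norm (S x) * norm x * (4 * ((1 + Br) * (1 + Br)))"
      by (intro norm_triangle_le add_mono est Bf Bg Br1)
    also have "\<dots> = norm x * (C * norm (S x))" by (simp add: C_def algebra_simps)
    finally have le: "norm x * norm x \<le> norm x * (C * norm (S x))" by (simp add: power2_eq_square)
    show ?thesis
    proof (cases "x = 0")
      case False
      then have "0 < norm x" by simp
      with le show ?thesis by (rule mult_left_le_imp_le)
    qed (use Bf(1) Bg(1) Br(1) in \<open>simp add: C_def\<close>)
  qed
  then have "surj S" by (rule selfadjoint_bounded_below_surj[OF saS])
  then obtain R where R: "\<And>x. S (R x) = x" by (metis surjD)
  have adjoint: "adjointable ip t"
    if "\<And>x. t (S x) = u x" "\<And>x y. ip (u x) y = ip x (u y)" for t u
    unfolding adjointable_def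
  proof (intro exI allI)
    show "ip (t x) y = ip x (R (u y))" for x y
      by (metis R saS that)
  qed
  show ?thesis
  proof (rule that)
    show "adjointable ip f" by (rule adjoint[OF fS p(1)])
    show "adjointable ip g" by (rule adjoint[OF gS q(1)])
    show "f h = h \<and> g h = 0" if "h \<in> H" for h using fg[OF that K0] by simp
    show "f k = 0 \<and> g k = k" if "k \<in> K" for k using fg[OF H0 that] by simp
  qed (rule fH gK)+
qed

text \<open>As \<open>P\<close> vanishes on \<open>K\<close>, the values of \<open>1 - P\<close> fill a submodule containing \<open>K\<close>; projecting them
  orthogonally onto \<open>K\<close> turns \<open>P\<close> into the idempotent \<open>P + q (1 - P)\<close> with range \<open>range P + K\<close>, to which
  \<open>range_idempotent_orth_complemented\<close> applies.\<close>

lemma orth_complemented_sum_if_idempotent: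
  assumes "submodule act K" "orth_complemented ip K"
    and "adjointable ip P" "idempotent P" "K \<subseteq> null_space P"
  shows "orth_complemented ip (range P + K)"
proof -
  obtain Q where adj: "\<And>x y. ip (P x) y = ip x (Q y)"
    using assms(3) unfolding adjointable_def by blast
  interpret P: bounded_linear P by (rule adjoint_pair_bounded_linear[OF adj])
  have PP: "P (P x) = P x" for x using assms(4) by (metis comp_apply idempotent_def)
  have PK: "P k = 0" if "k \<in> K" for k using assms(5) that by (auto simp: null_space_def)
  obtain q where q: "\<And>x y. ip (q x) y = ip x (q y)" "\<And>x. q x \<in> K" "\<And>x. x \<in> K \<Longrightarrow> q x = x"
    using orthogonal_projection_exists[OF assms(1,2)] by metis
  interpret q: bounded_linear q by (rule adjoint_pair_bounded_linear[OF q(1)])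
  define J where "J = (\<lambda>x. P x + q (x - P x))"
  have PJ: "P (J x) = P x" for x by (simp add: J_def P.add PP PK q(2))
  have "ip (J x) y = ip x (Q y + (q y - Q (q y)))" for x y
    by (simp add: J_def ip_add_left ip_add_right ip_diff_left ip_diff_right q(1) adj)
  moreover have "J (J x) = J x" for x
  proof -
    have "J x - P x \<in> K" by (simp add: J_def q(2))
    then have "q (J x - P (J x)) = J x - P x" by (simp add: PJ q(3))
    then show ?thesis using fun_cong[OF J_def, of "J x"] by (simp add: PJ)
  qed
  ultimately have "orth_complemented ip (range J)" by (rule range_idempotent_orth_complemented)
  moreover have "range J = range P + K"
  proof
    show "range J \<subseteq> range P + K" using q(2) by (auto simp: J_def intro!: set_plus_intro)
    show "range P + K \<subseteq> range J"
    proof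
      fix x assume "x \<in> range P + K"
      then obtain y k where x: "x = P y + k" "k \<in> K" by (auto elim!: set_plus_elim)
      then have "J x = x" by (simp add: J_def P.add PP PK q(3))
      then show "x \<in> range J" by (metis rangeI)
    qed
  qed
  ultimately show ?thesis by simp
qed

end

theorem theorem2p1:
  fixes act :: "'e::{complex_vector, banach} \<Rightarrow> 'a::cstar_algebra \<Rightarrow> 'e"
    and ip :: "'e \<Rightarrow> 'e \<Rightarrow> 'a"
    and H K :: "'e set"
  assumes "hilbert_cstar_module act ip"
    and "closed_submodule act H" and "orth_complemented ip H"
    and "closed_submodule act K" and "orth_complemented ip K"
  shows "(separated_pair act ip H K \<longleftrightarrow>
      (\<exists>P1\<in>adjointable_ops ip. \<exists>P2\<in>adjointable_ops ip. idempotent P1 \<and> idempotent P2 \<and>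
         P1 \<circ> P2 = (\<lambda>_. 0) \<and> P2 \<circ> P1 = (\<lambda>_. 0) \<and> range P1 = H \<and> range P2 = K)) \<and>
    (separated_pair act ip H K \<longleftrightarrow>
      (\<exists>P\<in>adjointable_ops ip. idempotent P \<and> range P = H \<and> K \<subseteq> null_space P))"
    (is "(?i \<longleftrightarrow> ?ii) \<and> (?i \<longleftrightarrow> ?iii)")
proof -
  interpret hilbert_cstar_module act ip by (rule assms(1))
  have subK: "submodule act K" and H0: "0 \<in> H" and K0: "0 \<in> K"
    using assms(2,4) by (auto simp: closed_submodule_def submodule_def)
  have "?i \<Longrightarrow> ?ii"
  proof -
    assume ?i
    then have sep: "H \<inter> K = {0}" "orth_complemented ip (H + K)"
      by (auto simp: separated_pair_def)
    obtain f g where adj: "adjointable ip f" "adjointable ip g"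
      and fH: "\<And>x. f x \<in> H" and gK: "\<And>x. g x \<in> K"
      and onH: "\<And>h. h \<in> H \<Longrightarrow> f h = h \<and> g h = 0"
      and onK: "\<And>k. k \<in> K \<Longrightarrow> f k = 0 \<and> g k = k"
      by (rule separated_pair_component_projections[OF assms(2-5) sep]) blast
    have "h \<in> range f" if "h \<in> H" for h using onH[OF that] by (intro range_eqI[of _ _ h]) simp
    then have "range f = H" using fH by blast
    moreover have "k \<in> range g" if "k \<in> K" for k
      using onK[OF that] by (intro range_eqI[of _ _ k]) simp
    then have "range g = K" using gK by blast
    moreover have "idempotent f" "idempotent g" "f \<circ> g = (\<lambda>_. 0)" "g \<circ> f = (\<lambda>_. 0)"
      using fH gK onH onK by (auto simp: idempotent_def)
    ultimately show ?ii
      using adj by (intro bexI[of _ f] bexI[of _ g] conjI)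
        (simp_all only: adjointable_ops_def mem_Collect_eq)
  qed
  moreover have "?ii \<Longrightarrow> ?iii"
  proof (elim bexE conjE)
    fix P1 P2 :: "'e \<Rightarrow> 'e"
    assume P: "P1 \<in> adjointable_ops ip" "idempotent P1" "range P1 = H"
      and comp: "P1 \<circ> P2 = (\<lambda>_. 0)" and K: "range P2 = K"
    have "K \<subseteq> null_space P1"
      unfolding K[symmetric] using fun_cong[OF comp] by (auto simp: null_space_def)
    then show ?iii using P by (intro bexI[of _ P1] conjI)
  qed
  moreover have "?iii \<Longrightarrow> ?i"
  proof (elim bexE conjE)
    fix P
    assume "P \<in> adjointable_ops ip" and P: "idempotent P" "range P = H" "K \<subseteq> null_space P"
    then have adj: "adjointable ip P" by (simp add: adjointable_ops_def)
    have "x = 0" if "x \<in> H" "x \<in> K" for x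
    proof -
      from that(1) obtain y where "x = P y" unfolding P(2)[symmetric] by blast
      then have "P x = x" using P(1) by (metis comp_apply idempotent_def)
      then show ?thesis using P(3) that(2) by (auto simp: null_space_def)
    qed
    then have "H \<inter> K = {0}" using H0 K0 by blast
    moreover have "orth_complemented ip (H + K)"
      using orth_complemented_sum_if_idempotent[OF subK assms(5) adj P(1,3)] by (simp only: P(2))
    ultimately show ?i
      unfolding separated_pair_def using assms(2,4) by (intro conjI)
  qed
  ultimately show ?thesis by satx
qed

end
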